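(* Let $\mathcal{A}\subset\mathbb{R}^d$ be a bounded alphabet (i.e. $\sup_{A\in\mathcal{A}}\|A\|_2<\infty$) with $0\in\mathcal{A}$, and let $p\ge 1$ be an integer. Let $\mathcal{G}_{\mathcal{A},p}:\mathbb{R}^d\to\mathbb{R}\cup\{\infty\}$ be the gauge$_p$ function of $\mathcal{A}$. Then the following hold. (i) The gauge$_p$ function has the equivalent definition $$\mathcal{G}_{\mathcal{A},p}(x)=\inf\Big\{\sum_{i=1}^p c_i \;:\; x=\sum_{i=1}^p c_iA_i,\ c_i\ge 0,\ A_i\in\mathcal{A},\ \forall i\in[p]\Big\}.$$ (ii) $\mathcal{G}_{\mathcal{A},p}(x)=0$ if and only if $x=0$. (iii) If $x$ does not admit a $p$-sparse decomposition in the alphabet $\mathcal{A}$, then $\mathcal{G}_{\mathcal{A},p}(x)=\infty$. (iv) If $\mathcal{G}_{\mathcal{A},p}(x)<\infty$, then any minimal decomposition of $x$ that achieves $\mathcal{G}_{\mathcal{A},p}(x)$ in the formula of (i) is $p$-sparse in the alphabet $\mathcal{A}$. (v) The convex conjugate of $\mathcal{G}_{\mathcal{A},p}$ is $$\mathcal{G}_{\mathcal{A},p}^*(z)=\begin{cases}0 & \text{if } \mathcal{D}_{\mathcal{A}}(z)\le 1,\\ \infty & \text{otherwise.}\end{cases}$$ (vi) The convex envelope of $\mathcal{G}_{\mathcal{A},p}$ is the gauge function $\mathcal{G}_{\mathcal{A}}$, i.e. $\mathcal{G}_{\mathcal{A},p}^{**}=\mathcal{G}_{\mathcal{A}}$.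 (vii) For every $x\in\mathbb{R}^d$, $$\mathcal{G}_{\mathcal{A},1}(x)\ge\mathcal{G}_{\mathcal{A},2}(x)\ge\cdots\ge\mathcal{G}_{\mathcal{A},d+1}(x)=\mathcal{G}_{\mathcal{A},d+2}(x)=\cdots=\mathcal{G}_{\mathcal{A}}(x).$$
   Context: An alphabet is a set $\mathcal{A}\subset\mathbb{R}^d$; its elements are called atoms. $[p]=\{1,\dots,p\}$, and $\mathrm{conv}$ denotes the convex hull. A slice formed by atoms $A_1,\dots,A_l\in\mathcal{A}$ is the set $\mathrm{conv}(\{A_1,\dots,A_l\}\cup\{0\})$; $\mathrm{slice}_p(\mathcal{A})$ is the set of all slices formed by at most $p$ atoms. Define $$\mathrm{conv}_p(\mathcal{A})=\bigcup_{\mathcal{S}\in\mathrm{slice}_p(\mathcal{A})}\mathcal{S}.$$ The gauge function is $\mathcal{G}_{\mathcal{A}}(x)=\inf\{t: x/t\in\mathrm{conv}(\mathcal{A}),\ t\ge0\}$ and the gauge$_p$ function is $\mathcal{G}_{\mathcal{A},p}(x)=\inf\{t: x/t\in\mathrm{conv}_p(\mathcal{A}),\ t\ge 0\}$, with the convention $0/0=0$ (and the infimum of the empty set is $\infty$). The dual function is $\mathcal{D}_{\mathcal{A}}(z)=\sup\{\langle z,x\rangle:\mathcal{G}_{\mathcal{A}}(x)\le1\}=\sup\{\langle z,A\rangle: A\in\mathcal{A}\}$. A $p$-sparse decomposition of $x$ in $\mathcal{A}$ is a representation $x=\sum_{i=1}^pc_iA_i$ with $c_i\ge0$ and $A_i\in\mathcal{A}$.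 The convex conjugate of $f$ is $f^*(z)=\sup_x\langle x,z\rangle-f(x)$ and $f^{**}=(f^* )^*$.
   Formalization: In (vi) the identity G_{A,p}** = G_A fails for some non-closed bounded alphabets, e.g. {0} ∪ {(1,s): 0<s≤1}; it is proved to hold exactly when G_A is lower semicontinuous, in particular when conv(A) is closed. The convex envelope claim is proved in full. *)

theory Defs
  imports "HOL-Analysis.Analysis"
begin

definition slices :: "nat \<Rightarrow> 'a::euclidean_space set \<Rightarrow> 'a set set" where
  "slices p A = {convex hull (S \<union> {0}) | S. S \<subseteq> A \<and> finite S \<and> card S \<le> p}"

definition conv_p :: "nat \<Rightarrow> 'a::euclidean_space set \<Rightarrow> 'a set" where
  "conv_p p A = \<Union> (slices p A)"

(* "x / t lies in C", with 0/0 = 0 and x/0 undefined for x other than 0.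
   In HOL x /\<^sub>R 0 = 0 for every x, so t = 0 needs its own case. *)
definition quotient_in :: "'a::euclidean_space \<Rightarrow> real \<Rightarrow> 'a set \<Rightarrow> bool" where
  "quotient_in x t C \<longleftrightarrow> (if t = 0 then x = 0 \<and> 0 \<in> C else x /\<^sub>R t \<in> C)"

(* In ereal, the infimum of the empty set is \<infinity>.
   (The name avoids gauge, which in HOL-Analysis is the Henstock-Kurzweil notion.) *)
definition gauge_of_set :: "'a::euclidean_space set \<Rightarrow> 'a \<Rightarrow> ereal" where
  "gauge_of_set C x = Inf {ereal t | t. 0 \<le> t \<and> quotient_in x t C}"

definition gauge_fun :: "'a::euclidean_space set \<Rightarrow> 'a \<Rightarrow> ereal" where
  "gauge_fun A = gauge_of_set (convex hull A)"

definition gauge_p_fun :: "'a::euclidean_space set \<Rightarrow> nat \<Rightarrow> 'a \<Rightarrow> ereal" where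
  "gauge_p_fun A p = gauge_of_set (conv_p p A)"

definition dual_fun :: "'a::euclidean_space set \<Rightarrow> 'a \<Rightarrow> ereal" where
  "dual_fun A z = Sup {ereal (z \<bullet> x) | x. gauge_fun A x \<le> 1}"

definition sparse_decomposition ::
    "'a::euclidean_space set \<Rightarrow> nat \<Rightarrow> 'a \<Rightarrow> (nat \<Rightarrow> real) \<Rightarrow> (nat \<Rightarrow> 'a) \<Rightarrow> bool" where
  "sparse_decomposition A p x c a \<longleftrightarrow>
     x = (\<Sum>i=1..p. c i *\<^sub>R a i) \<and> (\<forall>i\<in>{1..p}. 0 \<le> c i \<and> a i \<in> A)"

definition convex_conj :: "('a::euclidean_space \<Rightarrow> ereal) \<Rightarrow> 'a \<Rightarrow> ereal" where
  "convex_conj f z = (SUP x. ereal (x \<bullet> z) - f x)"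

(* convex_on and epigraph of HOL-Analysis only cover real-valued functions; for
   extended-valued ones convexity is convexity of the epigraph. *)
definition ereal_convex :: "('a::euclidean_space \<Rightarrow> ereal) \<Rightarrow> bool" where
  "ereal_convex f \<longleftrightarrow> convex {(x, r :: real). f x \<le> ereal r}"

definition is_convex_envelope ::
    "('a::euclidean_space \<Rightarrow> ereal) \<Rightarrow> ('a \<Rightarrow> ereal) \<Rightarrow> bool" where
  "is_convex_envelope f h \<longleftrightarrow>
     ereal_convex h \<and> (\<forall>x. h x \<le> f x) \<and>
     (\<forall>g. ereal_convex g \<and> (\<forall>x. g x \<le> f x) \<longrightarrow> (\<forall>x. g x \<le> h x))"

definition lower_semicont :: "('a::euclidean_space \<Rightarrow> ereal) \<Rightarrow> bool" where
  "lower_semicont f \<longleftrightarrow> (\<forall>r::real. closed {x. f x \<le> ereal r})"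

end

(* Both gauges are gauges of sets that are star-shaped about 0, so gauge x <= r means r >= 0 and
   x / t in the set for every t > r. Convexity of the gauge of conv A, and its lower semicontinuity
   when conv A is closed, can be read off from this.

   A convex minorant g of the gauge_p function satisfies g (t a) <= t on the atoms a, and convexity
   of its epigraph carries the bound to every point of t conv A; hence the gauge of A is the convex
   envelope. The conjugate of the gauge_p function is the indicator of the polar of A, and the
   biconjugate is the support function of that polar; separating a point from the sublevel set
   {gauge <= 1} shows that it equals the gauge exactly when the latter is lower semicontinuous.
   The stabilisation in (vii) is Caratheodory's theorem. *)
theory Submission
  imports Defs
begin

section \<open>Gauges of arbitrary and of star-shaped sets\<close>

lemma gauge_of_set_le:
  assumes "0 \<le> t" "quotient_in x t C"
  shows "gauge_of_set C x \<le> ereal t"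
  unfolding gauge_of_set_def using assms by (intro Inf_lower) auto

lemma gauge_of_set_nonneg: "0 \<le> gauge_of_set C x"
  unfolding gauge_of_set_def by (intro Inf_greatest) auto

lemma gauge_of_set_antimono: "C \<subseteq> D \<Longrightarrow> gauge_of_set D x \<le> gauge_of_set C x"
  unfolding gauge_of_set_def quotient_in_def by (rule Inf_superset_mono) auto

text \<open>The infimum need not be attained, so a bound by \<open>r\<close> yields membership only
  for scales strictly above \<open>r\<close>. Star-shapedness makes the admissible scales upward
  closed.\<close>

lemma gauge_of_set_le_iff:
  assumes star: "\<And>y u. y \<in> C \<Longrightarrow> 0 \<le> u \<Longrightarrow> u \<le> 1 \<Longrightarrow> u *\<^sub>R y \<in> C"
  shows "gauge_of_set C x \<le> ereal r \<longleftrightarrow> 0 \<le> r \<and> (\<forall>t>r. x /\<^sub>R t \<in> C)"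
proof
  assume L: "gauge_of_set C x \<le> ereal r"
  have "0 \<le> r"
    using order_trans[OF gauge_of_set_nonneg L] by simp
  moreover have "x /\<^sub>R t \<in> C" if "r < t" for t
  proof -
    have "gauge_of_set C x < ereal t"
      using L that by (metis ereal_less_eq(3) le_less_trans less_ereal.simps(1))
    then obtain s where s: "0 \<le> s" "quotient_in x s C" "s < t"
      unfolding gauge_of_set_def Inf_less_iff by auto
    show ?thesis
    proof (cases "s = 0")
      case True
      with s show ?thesis by (auto simp: quotient_in_def)
    next
      case False
      with s have "x /\<^sub>R s \<in> C" by (simp add: quotient_in_def)
      \<comment> \<open>An admissible scale \<open>s < t\<close> exists, and \<open>x / t\<close> is
        \<open>x / s\<close> shrunk towards 0 by the factor \<open>s / t\<close>.\<close>
      with s have "(s / t) *\<^sub>R (x /\<^sub>R s) \<in> C"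
        by (intro star[of "x /\<^sub>R s" "s / t"]) simp_all
      also have "(s / t) *\<^sub>R (x /\<^sub>R s) = x /\<^sub>R t"
        using False s by (simp add: field_simps)
      finally show ?thesis .
    qed
  qed
  ultimately show "0 \<le> r \<and> (\<forall>t>r. x /\<^sub>R t \<in> C)" by blast
next
  assume R: "0 \<le> r \<and> (\<forall>t>r. x /\<^sub>R t \<in> C)"
  show "gauge_of_set C x \<le> ereal r"
  proof (rule ereal_le_epsilon2)
    fix e :: real
    assume "0 < e"
    with R have "gauge_of_set C x \<le> ereal (r + e)"
      by (intro gauge_of_set_le) (auto simp: quotient_in_def)
    then show "gauge_of_set C x \<le> ereal r + ereal e" by simp
  qed
qed

section \<open>Slices, sparse decompositions and Caratheodory's theorem\<close>

lemma in_conv_p: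
  "x \<in> conv_p p A \<longleftrightarrow>
    (\<exists>S\<subseteq>A. finite S \<and> card S \<le> p \<and> x \<in> convex hull (insert 0 S))"
  unfolding conv_p_def slices_def Union_iff by (simp add: Bex_def) blast

lemma conv_p_iff:
  assumes "0 \<in> A"
  shows "y \<in> conv_p p A \<longleftrightarrow> (\<exists>c a. sparse_decomposition A p y c a \<and> (\<Sum>i=1..p. c i) \<le> 1)"
proof
  assume "y \<in> conv_p p A"
  then obtain S where S: "S \<subseteq> A" "finite S" "card S \<le> p" "y \<in> convex hull (insert 0 S)"
    by (auto simp: in_conv_p)
  then obtain u where u: "\<And>s. s \<in> insert 0 S \<Longrightarrow> 0 \<le> u s" "sum u (insert 0 S) = 1"
      "(\<Sum>s\<in>insert 0 S. u s *\<^sub>R s) = y"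
    by (auto simp: convex_hull_finite)
  have y: "y = (\<Sum>s\<in>S. u s *\<^sub>R s)"
    unfolding u(3)[symmetric] using S by (intro sum.mono_neutral_right) auto
  have le: "sum u S \<le> 1"
    unfolding u(2)[symmetric] using S u(1) by (intro sum_mono2) auto
  obtain h where h: "bij_betw h {1..card S} S"
    using ex_bij_betw_nat_finite_1 S(2) by blast
  have range_h: "h i \<in> S" if "i \<in> {1..card S}" for i
    using h that by (auto simp: bij_betw_def)
  \<comment> \<open>A slice may have fewer than \<open>p\<close> atoms. The remaining indices are
    padded with coefficient 0 and the atom 0, which belongs to \<open>A\<close> by
    assumption.\<close>
  define c where "c i = (if i \<le> card S then u (h i) else 0)" for i
  define a where "a i = (if i \<le> card S then h i else 0)" for i
  have "(\<Sum>i=1..p. c i) = (\<Sum>i=1..card S. u (h i))"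
    using S by (intro sum.mono_neutral_cong_right) (auto simp: c_def)
  also have "\<dots> = sum u S"
    by (rule sum.reindex_bij_betw[OF h])
  finally have sum_c: "(\<Sum>i=1..p. c i) \<le> 1" using le by simp
  have "(\<Sum>i=1..p. c i *\<^sub>R a i) = (\<Sum>i=1..card S. u (h i) *\<^sub>R h i)"
    using S by (intro sum.mono_neutral_cong_right) (auto simp: c_def a_def)
  also have "\<dots> = y"
    unfolding y by (rule sum.reindex_bij_betw[OF h])
  finally have "sparse_decomposition A p y c a"
    unfolding sparse_decomposition_def
    using assms range_h S(1) u(1) by (auto simp: c_def a_def)
  with sum_c show "\<exists>c a. sparse_decomposition A p y c a \<and> (\<Sum>i=1..p. c i) \<le> 1" by blast
next
  assume "\<exists>c a. sparse_decomposition A p y c a \<and> (\<Sum>i=1..p. c i) \<le> 1"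
  then obtain c a where y: "y = (\<Sum>i=1..p. c i *\<^sub>R a i)"
    and ca: "\<And>i. i \<in> {1..p} \<Longrightarrow> 0 \<le> c i \<and> a i \<in> A" and le: "(\<Sum>i=1..p. c i) \<le> 1"
    by (auto simp: sparse_decomposition_def)
  define S where "S = a ` {1..p}"
  \<comment> \<open>The extra index 0 carries the missing weight, placed by \<open>b\<close> on the
    point 0, so that the weights over \<open>{0..p}\<close> sum to 1 and the point is
    unchanged.\<close>
  define d where "d = c(0 := 1 - (\<Sum>i=1..p. c i))"
  define b where "b = a(0 := 0)"
  have split: "(\<Sum>i=0..p. f i) = f 0 + (\<Sum>i=1..p. f i)" for f :: "nat \<Rightarrow> 'c::comm_monoid_add"
    by (simp add: sum.atLeast_Suc_atMost)
  have "(\<Sum>i=1..p. d i) = (\<Sum>i=1..p. c i)"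
    by (intro sum.cong) (auto simp: d_def)
  then have sum_d: "(\<Sum>i=0..p. d i) = 1"
    unfolding split by (simp add: d_def)
  have "(\<Sum>i=1..p. d i *\<^sub>R b i) = y"
    unfolding y by (intro sum.cong) (auto simp: d_def b_def)
  then have "(\<Sum>i=0..p. d i *\<^sub>R b i) = y"
    unfolding split by (simp add: b_def)
  moreover have "(\<Sum>i=0..p. d i *\<^sub>R b i) \<in> convex hull (insert 0 S)"
  proof (rule convex_sum)
    fix i assume "i \<in> {0..p}"
    then show "0 \<le> d i" using ca le by (auto simp: d_def)
    have "b i \<in> insert 0 S"
      using \<open>i \<in> {0..p}\<close> by (cases "i = 0") (auto simp: b_def S_def)
    then show "b i \<in> convex hull (insert 0 S)" by (rule hull_inc)
  qed (use sum_d in auto)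
  moreover have "S \<subseteq> A" "finite S" "card S \<le> p"
    using ca card_image_le[of "{1..p}" a] by (auto simp: S_def)
  ultimately show "y \<in> conv_p p A"
    unfolding in_conv_p by auto
qed

lemma sparse_decomposition_scaleR:
  "sparse_decomposition A p x c a \<Longrightarrow> 0 \<le> t \<Longrightarrow>
    sparse_decomposition A p (t *\<^sub>R x) (\<lambda>i. t * c i) a"
  unfolding sparse_decomposition_def by (simp add: scaleR_sum_right)

lemma zero_in_conv_p: "0 \<in> conv_p p A"
  unfolding in_conv_p by (auto intro: exI[of _ "{}"])

lemma conv_p_mono: "q \<le> r \<Longrightarrow> conv_p q A \<subseteq> conv_p r A"
proof
  fix x assume "q \<le> r" "x \<in> conv_p q A"
  then obtain S where "S \<subseteq> A" "finite S" "card S \<le> r" "x \<in> convex hull (insert 0 S)"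
    using le_trans by (fastforce simp: in_conv_p)
  then show "x \<in> conv_p r A" by (auto simp: in_conv_p)
qed

lemma conv_p_subset_hull:
  assumes "0 \<in> A"
  shows "conv_p p A \<subseteq> convex hull A"
proof
  fix x assume "x \<in> conv_p p A"
  then obtain S where "S \<subseteq> A" "x \<in> convex hull (insert 0 S)"
    by (auto simp: in_conv_p)
  with assms show "x \<in> convex hull A"
    using hull_mono[of "insert 0 S" A convex] by auto
qed

text \<open>Caratheodory's theorem needs at most \<open>DIM('a) + 1\<close> atoms, and adjoining 0
  only enlarges the hull of those atoms.\<close>

lemma conv_p_eq_hull:
  fixes A :: "'a::euclidean_space set"
  assumes "0 \<in> A" "DIM('a) + 1 \<le> q"
  shows "conv_p q A = convex hull A"
proof
  show "convex hull A \<subseteq> conv_p q A"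
  proof
    fix x assume "x \<in> convex hull A"
    then obtain S where S: "finite S" "S \<subseteq> A" "card S \<le> DIM('a) + 1" "x \<in> convex hull S"
      by (auto simp: caratheodory[of A])
    then have "x \<in> convex hull (insert 0 S)"
      using hull_mono[of S "insert 0 S" convex] by auto
    with S assms(2) show "x \<in> conv_p q A"
      unfolding in_conv_p by (meson order_trans)
  qed
qed (rule conv_p_subset_hull[OF assms(1)])

section \<open>The gauge of the hull and the decomposition formula for the gauge of slices\<close>

lemma convex_hull_star:
  assumes "0 \<in> A" "y \<in> convex hull A" "0 \<le> u" "u \<le> 1"
  shows "u *\<^sub>R y \<in> convex hull A"
  using convexD[OF convex_convex_hull, of y A 0 u "1 - u"] assms by (simp add: hull_inc)

lemma gauge_fun_le_iff:
  assumes "0 \<in> A"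
  shows "gauge_fun A x \<le> ereal r \<longleftrightarrow> 0 \<le> r \<and> (\<forall>t>r. x /\<^sub>R t \<in> convex hull A)"
  unfolding gauge_fun_def using assms by (intro gauge_of_set_le_iff convex_hull_star)

text \<open>Multiplying coefficients by \<open>t\<close> matches decompositions of
  \<open>x / t\<close> of weight at most 1 with decompositions of \<open>x\<close> of weight at most
  \<open>t\<close>; conversely, a decomposition is normalised by its own weight.\<close>

lemma gauge_p_eq_Inf:
  assumes "0 \<in> A"
  shows "gauge_p_fun A p x =
    Inf {ereal (\<Sum>i=1..p. c i) | c a. sparse_decomposition A p x c a}" (is "_ = Inf ?D")
proof (rule antisym)
  show "gauge_p_fun A p x \<le> Inf ?D"
  proof (rule Inf_greatest, clarify)
    fix c a assume ca: "sparse_decomposition A p x c a"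
    define t where "t = (\<Sum>i=1..p. c i)"
    have "0 \<le> t"
      unfolding t_def using ca by (intro sum_nonneg) (auto simp: sparse_decomposition_def)
    moreover have "quotient_in x t (conv_p p A)"
    proof (cases "t = 0")
      case True
      \<comment> \<open>Nonnegative coefficients with sum 0 all vanish, which leaves exactly the
        admissible quotient 0/0.\<close>
      then have "\<forall>i\<in>{1..p}. c i = 0"
        unfolding t_def using ca
        by (subst (asm) sum_nonneg_eq_0_iff) (auto simp: sparse_decomposition_def)
      then have "x = 0" using ca by (simp add: sparse_decomposition_def)
      with True show ?thesis by (simp add: quotient_in_def zero_in_conv_p)
    next
      case False
      with \<open>0 \<le> t\<close> have "sparse_decomposition A p (x /\<^sub>R t) (\<lambda>i. inverse t * c i) a"
        by (intro sparse_decomposition_scaleR ca) auto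
      moreover have "(\<Sum>i=1..p. inverse t * c i) = 1"
        unfolding sum_distrib_left[symmetric] using False by (simp add: t_def)
      ultimately have "x /\<^sub>R t \<in> conv_p p A"
        unfolding conv_p_iff[OF assms] by (metis order_refl)
      with False show ?thesis by (simp add: quotient_in_def)
    qed
    ultimately show "gauge_p_fun A p x \<le> ereal (\<Sum>i=1..p. c i)"
      unfolding gauge_p_fun_def t_def[symmetric] by (rule gauge_of_set_le)
  qed
  show "Inf ?D \<le> gauge_p_fun A p x"
    unfolding gauge_p_fun_def gauge_of_set_def
  proof (rule Inf_greatest, clarify)
    fix t :: real assume t: "0 \<le> t" "quotient_in x t (conv_p p A)"
    \<comment> \<open>For \<open>t = 0\<close> this holds as well: then \<open>x = 0\<close>, and
      the total division returns 0, a point of \<open>conv_p p A\<close>.\<close>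
    then have "x /\<^sub>R t \<in> conv_p p A" and x: "x = t *\<^sub>R (x /\<^sub>R t)"
      by (auto simp: quotient_in_def zero_in_conv_p split: if_splits)
    then obtain c a where ca: "sparse_decomposition A p (x /\<^sub>R t) c a" "(\<Sum>i=1..p. c i) \<le> 1"
      unfolding conv_p_iff[OF assms] by blast
    have "sparse_decomposition A p x (\<lambda>i. t * c i) a"
      using sparse_decomposition_scaleR[OF ca(1) t(1)] x by simp
    then have "Inf ?D \<le> ereal (\<Sum>i=1..p. t * c i)"
      by (intro Inf_lower) blast
    also have "(\<Sum>i=1..p. t * c i) \<le> t"
      unfolding sum_distrib_left[symmetric] using ca(2) t(1) by (simp add: mult_left_le)
    finally show "Inf ?D \<le> ereal t" by simp
  qed
qed

lemma gauge_p_zero: "gauge_p_fun A p 0 = 0"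
  using gauge_of_set_le[of 0 0 "conv_p p A"] gauge_of_set_nonneg[of "conv_p p A" 0]
  by (simp add: gauge_p_fun_def quotient_in_def zero_in_conv_p zero_ereal_def antisym)

text \<open>A single term of weight \<open>t\<close> suffices. This bound along rays through atoms
  drives both the conjugate and the envelope.\<close>

lemma gauge_p_atom_le:
  assumes "0 \<in> A" "1 \<le> p" "a \<in> A" "0 \<le> t"
  shows "gauge_p_fun A p (t *\<^sub>R a) \<le> ereal t"
proof -
  let ?c = "\<lambda>i::nat. if i = 1 then t else 0"
  have "sparse_decomposition A p (t *\<^sub>R a) ?c (\<lambda>_. a)"
    using assms by (auto simp: sparse_decomposition_def scaleR_sum_left[symmetric])
  moreover have "(\<Sum>i=1..p. ?c i) = t" using assms by simp
  ultimately show ?thesis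
    unfolding gauge_p_eq_Inf[OF assms(1)] by (intro Inf_lower) force
qed

text \<open>If all atoms have norm at most \<open>M\<close>, the triangle inequality bounds the
  weight of every decomposition below by \<open>norm x / M\<close>; boundedness of \<open>A\<close>
  enters here.\<close>

lemma gauge_p_eq_0_iff:
  assumes "bounded A" "0 \<in> A"
  shows "gauge_p_fun A p x = 0 \<longleftrightarrow> x = 0"
proof
  assume G: "gauge_p_fun A p x = 0"
  obtain M where M: "0 < M" "\<And>a. a \<in> A \<Longrightarrow> norm a \<le> M"
    using assms(1) by (auto simp: bounded_pos)
  have "ereal (norm x / M) \<le> gauge_p_fun A p x"
    unfolding gauge_p_eq_Inf[OF assms(2)]
  proof (rule Inf_greatest, clarify)
    fix c a assume ca: "sparse_decomposition A p x c a"
    then have "norm x \<le> (\<Sum>i=1..p. norm (c i *\<^sub>R a i))"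
      unfolding sparse_decomposition_def by (metis norm_sum)
    also have "\<dots> \<le> (\<Sum>i=1..p. c i * M)"
      using ca M by (intro sum_mono) (auto simp: sparse_decomposition_def intro!: mult_left_mono)
    finally show "ereal (norm x / M) \<le> ereal (\<Sum>i=1..p. c i)"
      using M(1) by (simp add: sum_distrib_right[symmetric] divide_le_eq)
  qed
  with G M(1) show "x = 0" by (simp add: zero_ereal_def divide_le_0_iff)
qed (simp add: gauge_p_zero)

section \<open>The polar of the alphabet and the conjugate\<close>

lemma dual_fun_le_one_iff:
  assumes "0 \<in> A"
  shows "dual_fun A z \<le> 1 \<longleftrightarrow> (\<forall>a\<in>A. z \<bullet> a \<le> 1)"
proof
  assume D: "dual_fun A z \<le> 1"
  show "\<forall>a\<in>A. z \<bullet> a \<le> 1"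
  proof
    fix a assume "a \<in> A"
    then have "gauge_fun A a \<le> 1"
      using gauge_of_set_le[of 1 a "convex hull A"]
      by (simp add: gauge_fun_def quotient_in_def hull_inc one_ereal_def)
    then have "ereal (z \<bullet> a) \<le> dual_fun A z"
      unfolding dual_fun_def by (intro Sup_upper) blast
    with D show "z \<bullet> a \<le> 1" using order_trans by fastforce
  qed
next
  assume R: "\<forall>a\<in>A. z \<bullet> a \<le> 1"
  then have "convex hull A \<subseteq> {y. z \<bullet> y \<le> 1}"
    by (intro hull_minimal) (auto simp: convex_halfspace_le)
  show "dual_fun A z \<le> 1"
    unfolding dual_fun_def
  proof (rule Sup_least, clarify)
    fix x assume "gauge_fun A x \<le> 1"
    then have *: "x /\<^sub>R t \<in> convex hull A" if "1 < t" for t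
      using that by (simp add: one_ereal_def gauge_fun_le_iff[OF assms])
    \<comment> \<open>Membership in the hull is known only for scales above 1, so the bound 1 is
      reached by letting \<open>t\<close> decrease to 1.\<close>
    have "z \<bullet> x \<le> t" if "1 < t" for t
    proof -
      have "z \<bullet> (x /\<^sub>R t) \<le> 1"
        using *[OF that] \<open>convex hull A \<subseteq> _\<close> by blast
      with that show ?thesis by (simp add: field_simps)
    qed
    then show "ereal (z \<bullet> x) \<le> 1" by (simp add: one_ereal_def dense_ge)
  qed
qed

text \<open>For \<open>z\<close> in the polar, the hull lies in a half-space, and scaling by
  \<open>t\<close> gives the bound. It serves the conjugate as well as the upper bound on the
  biconjugate.\<close>

lemma inner_le_gauge_fun:
  assumes "0 \<in> A" "dual_fun A z \<le> 1"
  shows "ereal (x \<bullet> z) \<le> gauge_fun A x"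
  unfolding gauge_fun_def gauge_of_set_def
proof (rule Inf_greatest, clarify)
  fix t :: real assume t: "0 \<le> t" "quotient_in x t (convex hull A)"
  have hull: "convex hull A \<subseteq> {y. z \<bullet> y \<le> 1}"
    using assms by (intro hull_minimal) (auto simp: convex_halfspace_le dual_fun_le_one_iff)
  show "ereal (x \<bullet> z) \<le> ereal t"
  proof (cases "t = 0")
    case False
    then have "z \<bullet> (x /\<^sub>R t) \<le> 1"
      using t hull by (auto simp: quotient_in_def)
    with False t show ?thesis by (simp add: field_simps inner_commute)
  qed (use t in \<open>auto simp: quotient_in_def\<close>)
qed

lemma gauge_fun_le_gauge_p:
  "0 \<in> A \<Longrightarrow> gauge_fun A x \<le> gauge_p_fun A p x"
  unfolding gauge_fun_def gauge_p_fun_def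
  by (rule gauge_of_set_antimono[OF conv_p_subset_hull])

text \<open>On the polar no term is positive and \<open>x = 0\<close> contributes 0. Off the polar,
  the terms are unbounded along the ray through an atom \<open>a\<close> with
  \<open>z \<bullet> a > 1\<close>.\<close>

lemma convex_conj_gauge_p:
  assumes "0 \<in> A" "1 \<le> p"
  shows "convex_conj (gauge_p_fun A p) z = (if dual_fun A z \<le> 1 then 0 else \<infinity>)"
proof (cases "dual_fun A z \<le> 1")
  case True
  have "ereal (x \<bullet> z) - gauge_p_fun A p x \<le> 0" for x
    using order_trans[OF inner_le_gauge_fun[OF assms(1) True] gauge_fun_le_gauge_p[OF assms(1)], of x p]
    by (cases "gauge_p_fun A p x") (auto simp: zero_ereal_def)
  moreover have "ereal (0 \<bullet> z) - gauge_p_fun A p 0 = 0"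
    by (simp add: gauge_p_zero zero_ereal_def)
  ultimately have "convex_conj (gauge_p_fun A p) z = 0"
    unfolding convex_conj_def by (intro antisym SUP_least) (auto intro: SUP_upper2[of 0])
  with True show ?thesis by simp
next
  case False
  then obtain a where a: "a \<in> A" "z \<bullet> a > 1"
    using assms(1) by (auto simp: dual_fun_le_one_iff not_le)
  have "ereal B \<le> convex_conj (gauge_p_fun A p) z" for B
  proof -
    \<comment> \<open>Solves \<open>s * (z \<bullet> a - 1) = \<bar>B\<bar>\<close>, so the term at
      \<open>s *\<^sub>R a\<close> is at least \<open>B\<close>.\<close>
    define s where "s = \<bar>B\<bar> / (z \<bullet> a - 1)"
    have s: "0 \<le> s" "s * (z \<bullet> a) - s = \<bar>B\<bar>"
      using a(2) right_diff_distrib[of s "z \<bullet> a" 1] by (simp_all add: s_def)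
    have "ereal B \<le> ereal ((s *\<^sub>R a) \<bullet> z) - ereal s"
      using s by (simp add: inner_commute)
    also have "\<dots> \<le> ereal ((s *\<^sub>R a) \<bullet> z) - gauge_p_fun A p (s *\<^sub>R a)"
      using gauge_p_atom_le[OF assms a(1) s(1)] by (intro ereal_minus_mono) auto
    also have "\<dots> \<le> convex_conj (gauge_p_fun A p) z"
      unfolding convex_conj_def by (rule SUP_upper) simp
    finally show ?thesis .
  qed
  then have "convex_conj (gauge_p_fun A p) z = \<infinity>" by (rule ereal_top)
  with False show ?thesis by simp
qed

section \<open>The convex envelope\<close>

lemma ereal_convex_gauge_fun:
  assumes "0 \<in> A"
  shows "ereal_convex (gauge_fun A)"
  unfolding ereal_convex_def
proof (rule convexI)
  fix P Q :: "'a \<times> real" and u v :: real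
  assume P: "P \<in> {(x, r). gauge_fun A x \<le> ereal r}" and Q: "Q \<in> {(x, r). gauge_fun A x \<le> ereal r}"
    and uv: "0 \<le> u" "0 \<le> v" "u + v = 1"
  obtain x r y s where PQ: "P = (x, r)" "Q = (y, s)" by (metis surj_pair)
  have rs: "0 \<le> r" "0 \<le> s"
    and x: "\<forall>t>r. x /\<^sub>R t \<in> convex hull A" and y: "\<forall>t>s. y /\<^sub>R t \<in> convex hull A"
    using P Q by (simp_all add: PQ gauge_fun_le_iff[OF assms])
  have "gauge_fun A (u *\<^sub>R x + v *\<^sub>R y) \<le> ereal (u * r + v * s)"
    unfolding gauge_fun_le_iff[OF assms]
  proof (intro conjI allI impI)
    show "0 \<le> u * r + v * s" using uv rs by simp
    fix t assume t: "u * r + v * s < t"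
    with \<open>0 \<le> u * r + v * s\<close> have "0 < t" by linarith
    \<comment> \<open>The slack \<open>e\<close> is added to both \<open>r\<close> and
      \<open>s\<close>: the scales then lie strictly above the bounds, and their weighted mean is
      exactly \<open>t\<close>.\<close>
    define e where "e = t - (u * r + v * s)"
    have e: "0 < e" using t by (simp add: e_def)
    have "u * e + v * e = e" using uv(3) by (metis distrib_right mult_1)
    then have "u * (r + e) + v * (s + e) = t"
      by (simp add: distrib_left) (simp add: e_def)
    then have weights: "u * (r + e) / t + v * (s + e) / t = 1"
      using \<open>0 < t\<close> by (simp add: add_divide_distrib[symmetric])
    have "(u * (r + e) / t) *\<^sub>R (x /\<^sub>R (r + e)) + (v * (s + e) / t) *\<^sub>R (y /\<^sub>R (s + e))
        \<in> convex hull A"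
      using uv rs e x y \<open>0 < t\<close> weights by (intro convexD[OF convex_convex_hull]) auto
    also have "(u * (r + e) / t) *\<^sub>R (x /\<^sub>R (r + e)) = (u / t) *\<^sub>R x"
      using rs e by simp
    also have "(v * (s + e) / t) *\<^sub>R (y /\<^sub>R (s + e)) = (v / t) *\<^sub>R y"
      using rs e by simp
    finally show "(u *\<^sub>R x + v *\<^sub>R y) /\<^sub>R t \<in> convex hull A"
      by (simp add: scaleR_add_right divide_inverse mult.commute)
  qed
  then show "u *\<^sub>R P + v *\<^sub>R Q \<in> {(x, r). gauge_fun A x \<le> ereal r}"
    by (simp add: PQ)
qed

lemma convex_minorant_le_gauge_fun:
  assumes "0 \<in> A" "1 \<le> p" "ereal_convex g" "\<And>x. g x \<le> gauge_p_fun A p x"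
  shows "g x \<le> gauge_fun A x"
  unfolding gauge_fun_def gauge_of_set_def
proof (rule Inf_greatest, clarify)
  fix t :: real assume t: "0 \<le> t" "quotient_in x t (convex hull A)"
  let ?E = "{(x, r :: real). g x \<le> ereal r}"
  show "g x \<le> ereal t"
  proof (cases "t = 0")
    case True
    with t show ?thesis
      using assms(4)[of 0] by (simp add: quotient_in_def gauge_p_zero zero_ereal_def)
  next
    case False
    \<comment> \<open>This is the preimage of the epigraph of \<open>g\<close> under the affine map
      sending \<open>y\<close> to \<open>(t *\<^sub>R y, t)\<close>. Once it contains the atoms, it
      contains their hull.\<close>
    have "convex {y. (t *\<^sub>R y, t) \<in> ?E}"
    proof (rule convexI)
      fix y y' and u v :: real
      assume *: "y \<in> {y. (t *\<^sub>R y, t) \<in> ?E}" "y' \<in> {y. (t *\<^sub>R y, t) \<in> ?E}"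
        "0 \<le> u" "0 \<le> v" "u + v = 1"
      then have "u *\<^sub>R (t *\<^sub>R y, t) + v *\<^sub>R (t *\<^sub>R y', t) \<in> ?E"
        using assms(3) unfolding ereal_convex_def by (intro convexD) auto
      moreover have "u * t + v * t = t" using *(5) by (metis distrib_right mult_1)
      ultimately show "u *\<^sub>R y + v *\<^sub>R y' \<in> {y. (t *\<^sub>R y, t) \<in> ?E}"
        by (simp add: scaleR_add_right mult.commute)
    qed
    moreover have "A \<subseteq> {y. (t *\<^sub>R y, t) \<in> ?E}"
      using gauge_p_atom_le[OF assms(1,2) _ t(1)] assms(4) by (auto intro: order_trans)
    ultimately have "convex hull A \<subseteq> {y. (t *\<^sub>R y, t) \<in> ?E}"
      by (rule hull_minimal[rotated])
    then have "(t *\<^sub>R (x /\<^sub>R t), t) \<in> ?E"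
      using t False by (auto simp: quotient_in_def)
    with False show ?thesis by simp
  qed
qed

lemma is_convex_envelope_gauge_fun:
  assumes "0 \<in> A" "1 \<le> p"
  shows "is_convex_envelope (gauge_p_fun A p) (gauge_fun A)"
  unfolding is_convex_envelope_def
  by (auto intro: ereal_convex_gauge_fun gauge_fun_le_gauge_p convex_minorant_le_gauge_fun assms)

section \<open>The biconjugate and lower semicontinuity\<close>

lemma biconj_gauge_p:
  assumes "0 \<in> A" "1 \<le> p"
  shows "convex_conj (convex_conj (gauge_p_fun A p)) x =
    (SUP z\<in>{z. dual_fun A z \<le> 1}. ereal (x \<bullet> z))"
  unfolding convex_conj_def[of "convex_conj _"] convex_conj_gauge_p[OF assms]
proof (rule antisym)
  show "(SUP z. ereal (z \<bullet> x) - (if dual_fun A z \<le> 1 then 0 else \<infinity>))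
      \<le> (SUP z\<in>{z. dual_fun A z \<le> 1}. ereal (x \<bullet> z))"
    \<comment> \<open>Outside the polar the term is \<open>-\<infinity>\<close> and drops out of the
      supremum.\<close>
    by (rule SUP_least) (auto simp: inner_commute intro: SUP_upper)
  show "(SUP z\<in>{z. dual_fun A z \<le> 1}. ereal (x \<bullet> z))
      \<le> (SUP z. ereal (z \<bullet> x) - (if dual_fun A z \<le> 1 then 0 else \<infinity>))"
  proof (rule SUP_least)
    fix z assume "z \<in> {z. dual_fun A z \<le> 1}"
    then show "ereal (x \<bullet> z) \<le> (SUP z. ereal (z \<bullet> x) - (if dual_fun A z \<le> 1 then 0 else \<infinity>))"
      by (intro SUP_upper2[of z]) (auto simp: inner_commute)
  qed
qed

text \<open>Sublevel sets of a support function are intersections of closed half-spaces. Hence lower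
  semicontinuity is necessary for equality with the gauge.\<close>

lemma lower_semicont_biconj_gauge_p:
  assumes "0 \<in> A" "1 \<le> p"
  shows "lower_semicont (convex_conj (convex_conj (gauge_p_fun A p)))"
  unfolding lower_semicont_def
proof
  fix r :: real
  have "{x. convex_conj (convex_conj (gauge_p_fun A p)) x \<le> ereal r} =
      (\<Inter>z\<in>{z. dual_fun A z \<le> 1}. {x. z \<bullet> x \<le> r})"
    by (auto simp: biconj_gauge_p[OF assms] SUP_le_iff inner_commute)
  then show "closed {x. convex_conj (convex_conj (gauge_p_fun A p)) x \<le> ereal r}"
    by (auto intro: closed_halfspace_le)
qed

text \<open>A bipolar argument: with \<open>r\<close> strictly between the two values, a hyperplane
  separating \<open>x / r\<close> from the closed convex set \<open>?L\<close> yields a polar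
  element \<open>w\<close> with \<open>x \<bullet> w > r\<close>.\<close>

lemma gauge_fun_le_biconj:
  assumes "0 \<in> A" "1 \<le> p" "lower_semicont (gauge_fun A)"
  shows "gauge_fun A x \<le> convex_conj (convex_conj (gauge_p_fun A p)) x"
proof (rule ccontr)
  let ?b = "convex_conj (convex_conj (gauge_p_fun A p)) x"
  assume "\<not> ?thesis"
  then have "?b < gauge_fun A x" by simp
  then obtain r where r: "?b < ereal r" "ereal r < gauge_fun A x"
    using ereal_dense2 by blast
  \<comment> \<open>The polar contains 0, so the biconjugate is nonnegative and \<open>r\<close> is
    positive, which permits division by \<open>r\<close>.\<close>
  have "ereal (x \<bullet> 0) \<le> ?b"
    unfolding biconj_gauge_p[OF assms(1,2)]
    by (rule SUP_upper) (simp add: dual_fun_le_one_iff[OF assms(1)])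
  with r(1) have "ereal 0 < ereal r" by (metis inner_zero_right le_less_trans)
  then have "0 < r" by simp
  let ?L = "{y. gauge_fun A y \<le> ereal 1}"
  have "closed ?L" using assms(3) unfolding lower_semicont_def by blast
  moreover have "convex ?L"
  proof (rule convexI)
    fix y y' and u v :: real
    assume *: "y \<in> ?L" "y' \<in> ?L" "0 \<le> u" "0 \<le> v" "u + v = 1"
    then have "u *\<^sub>R (y, 1) + v *\<^sub>R (y', 1) \<in> {(x, r :: real). gauge_fun A x \<le> ereal r}"
      using ereal_convex_gauge_fun[OF assms(1)] unfolding ereal_convex_def
      by (intro convexD) auto
    with *(5) show "u *\<^sub>R y + v *\<^sub>R y' \<in> ?L" by simp
  qed
  moreover have "x /\<^sub>R r \<notin> ?L"
  proof
    assume "x /\<^sub>R r \<in> ?L"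
    then have L: "x /\<^sub>R r /\<^sub>R t \<in> convex hull A" if "1 < t" for t
      using that by (simp add: gauge_fun_le_iff[OF assms(1)])
    have "x /\<^sub>R t \<in> convex hull A" if "r < t" for t
      using L[of "t / r"] that \<open>0 < r\<close> by (simp add: inverse_eq_divide)
    with \<open>0 < r\<close> have "gauge_fun A x \<le> ereal r"
      by (simp add: gauge_fun_le_iff[OF assms(1)])
    with r(2) show False by simp
  qed
  ultimately obtain z b where z: "z \<bullet> (x /\<^sub>R r) < b" "\<forall>y\<in>?L. b < z \<bullet> y"
    using separating_hyperplane_closed_point by blast
  have A_L: "A \<subseteq> ?L"
    using gauge_of_set_le[of 1 _ "convex hull A"]
    by (auto simp: gauge_fun_def quotient_in_def hull_inc)
  with assms(1) z(2) have "b < 0" by fastforce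
  \<comment> \<open>Since 0 lies in \<open>?L\<close>, the offset \<open>b\<close> is negative.
    Dividing by it reverses both separation inequalities and normalises the bound on the atoms to
    1.\<close>
  define w where "w = z /\<^sub>R b"
  have "w \<bullet> a \<le> 1" if "a \<in> A" for a
    using A_L that z(2) \<open>b < 0\<close> unfolding w_def by (fastforce simp: field_simps)
  then have "ereal (x \<bullet> w) \<le> ?b"
    unfolding biconj_gauge_p[OF assms(1,2)]
    by (intro SUP_upper) (simp add: dual_fun_le_one_iff[OF assms(1)])
  with r(1) have "x \<bullet> w < r" by (metis le_less_trans less_ereal.simps(1))
  moreover have "r < x \<bullet> w"
    using z(1) \<open>b < 0\<close> \<open>0 < r\<close> unfolding w_def by (simp add: field_simps inner_commute)
  ultimately show False by simp
qed

lemma biconj_eq_gauge_fun_iff: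
  assumes "0 \<in> A" "1 \<le> p"
  shows "convex_conj (convex_conj (gauge_p_fun A p)) = gauge_fun A \<longleftrightarrow>
    lower_semicont (gauge_fun A)"
proof
  assume "lower_semicont (gauge_fun A)"
  moreover have "convex_conj (convex_conj (gauge_p_fun A p)) x \<le> gauge_fun A x" for x
    unfolding biconj_gauge_p[OF assms] using inner_le_gauge_fun[OF assms(1)]
    by (auto intro: SUP_least)
  ultimately show "convex_conj (convex_conj (gauge_p_fun A p)) = gauge_fun A"
    using gauge_fun_le_biconj[OF assms] by (intro ext antisym) auto
qed (use lower_semicont_biconj_gauge_p[OF assms] in simp)

text \<open>By \<open>gauge_fun_le_iff\<close>, a sublevel set at a nonnegative level is an
  intersection of preimages of the hull under continuous scalings; at a negative level it is
  empty.\<close>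

lemma lower_semicont_gauge_fun:
  assumes "0 \<in> A" "closed (convex hull A)"
  shows "lower_semicont (gauge_fun A)"
  unfolding lower_semicont_def
proof
  fix r :: real
  have "closed ((\<lambda>x. x /\<^sub>R t) -` (convex hull A))" for t
    using assms(2) by (intro closed_vimage continuous_intros)
  then have "closed (\<Inter>t\<in>{r<..}. (\<lambda>x. x /\<^sub>R t) -` (convex hull A))"
    by blast
  moreover have "{x. gauge_fun A x \<le> ereal r} =
      (if 0 \<le> r then \<Inter>t\<in>{r<..}. (\<lambda>x. x /\<^sub>R t) -` (convex hull A) else {})"
    by (auto simp: gauge_fun_le_iff[OF assms(1)])
  ultimately show "closed {x. gauge_fun A x \<le> ereal r}" by simp
qed

theorem proposition3p4:
  fixes A :: "'a::euclidean_space set" and p :: nat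
  assumes "bounded A" and "0 \<in> A" and "1 \<le> p"
  shows
    \<comment> \<open>(i)\<close>
    "(\<forall>x. gauge_p_fun A p x =
        Inf {ereal (\<Sum>i=1..p. c i) | c a.
               x = (\<Sum>i=1..p. c i *\<^sub>R a i) \<and> (\<forall>i\<in>{1..p}. 0 \<le> c i \<and> a i \<in> A)}) \<and>
     \<comment> \<open>(ii)\<close>
     (\<forall>x. gauge_p_fun A p x = 0 \<longleftrightarrow> x = 0) \<and>
     \<comment> \<open>(iii)\<close>
     (\<forall>x. (\<nexists>c a. sparse_decomposition A p x c a) \<longrightarrow> gauge_p_fun A p x = \<infinity>) \<and>
     \<comment> \<open>(iv)\<close>
     (\<forall>x. gauge_p_fun A p x < \<infinity> \<longrightarrow>
        (\<forall>c a. x = (\<Sum>i=1..p. c i *\<^sub>R a i) \<and> (\<forall>i\<in>{1..p}. 0 \<le> c i \<and> a i \<in> A) \<and>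
               ereal (\<Sum>i=1..p. c i) = gauge_p_fun A p x \<longrightarrow>
               sparse_decomposition A p x c a)) \<and>
     \<comment> \<open>(v)\<close>
     (\<forall>z. convex_conj (gauge_p_fun A p) z = (if dual_fun A z \<le> 1 then 0 else \<infinity>)) \<and>
     \<comment> \<open>(vi)\<close>
     is_convex_envelope (gauge_p_fun A p) (gauge_fun A) \<and>
     (convex_conj (convex_conj (gauge_p_fun A p)) = gauge_fun A \<longleftrightarrow>
        lower_semicont (gauge_fun A)) \<and>
     (closed (convex hull A) \<longrightarrow>
        convex_conj (convex_conj (gauge_p_fun A p)) = gauge_fun A) \<and>
     \<comment> \<open>(vii)\<close>
     (\<forall>x. (\<forall>q r. 1 \<le> q \<and> q \<le> r \<longrightarrow> gauge_p_fun A r x \<le> gauge_p_fun A q x) \<and>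
          (\<forall>q. DIM('a) + 1 \<le> q \<longrightarrow> gauge_p_fun A q x = gauge_fun A x))"
proof (intro conjI allI impI)
  show eq: "gauge_p_fun A p x = Inf {ereal (\<Sum>i=1..p. c i) | c a.
      x = (\<Sum>i=1..p. c i *\<^sub>R a i) \<and> (\<forall>i\<in>{1..p}. 0 \<le> c i \<and> a i \<in> A)}" for x
    using gauge_p_eq_Inf[OF assms(2)] by (simp add: sparse_decomposition_def)
  show "gauge_p_fun A p x = 0 \<longleftrightarrow> x = 0" for x
    by (rule gauge_p_eq_0_iff[OF assms(1,2)])
  show "gauge_p_fun A p x = \<infinity>" if "\<nexists>c a. sparse_decomposition A p x c a" for x
    \<comment> \<open>The infimum runs over the empty set, whose value in \<open>ereal\<close> is
      the top element.\<close>
    using that by (simp add: gauge_p_eq_Inf[OF assms(2)] top_ereal_def)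
  show "sparse_decomposition A p x c a"
    if "x = (\<Sum>i=1..p. c i *\<^sub>R a i) \<and> (\<forall>i\<in>{1..p}. 0 \<le> c i \<and> a i \<in> A) \<and>
      ereal (\<Sum>i=1..p. c i) = gauge_p_fun A p x" for x c a
    using that by (simp add: sparse_decomposition_def)
  show "convex_conj (gauge_p_fun A p) z = (if dual_fun A z \<le> 1 then 0 else \<infinity>)" for z
    by (rule convex_conj_gauge_p[OF assms(2,3)])
  show "is_convex_envelope (gauge_p_fun A p) (gauge_fun A)"
    by (rule is_convex_envelope_gauge_fun[OF assms(2,3)])
  show "convex_conj (convex_conj (gauge_p_fun A p)) = gauge_fun A \<longleftrightarrow>
      lower_semicont (gauge_fun A)"
    by (rule biconj_eq_gauge_fun_iff[OF assms(2,3)])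
  show "convex_conj (convex_conj (gauge_p_fun A p)) = gauge_fun A" if "closed (convex hull A)"
    using biconj_eq_gauge_fun_iff[OF assms(2,3)] lower_semicont_gauge_fun[OF assms(2) that] by blast
  show "gauge_p_fun A r x \<le> gauge_p_fun A q x" if "1 \<le> q \<and> q \<le> r" for x q r
    using that by (simp add: gauge_p_fun_def gauge_of_set_antimono conv_p_mono)
  show "gauge_p_fun A q x = gauge_fun A x" if "DIM('a) + 1 \<le> q" for x q
    using that assms(2) by (simp add: gauge_p_fun_def gauge_fun_def conv_p_eq_hull)
qed

end
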